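(* Let $I\subset\mathbb{R}$ be an interval and let $(\gamma,\nu_1,\nu_2,\nu_3):I\to\mathbb{R}^4\times\Delta$ be a framed curve. Then the following are equivalent: (1) $(\gamma,\nu_1,\nu_2,\nu_3)$ is a Bertrand curve. (2) $(\gamma,\nu_1,\nu_2,\nu_3)$ is a second type of Mannheim curve. (3) $(\gamma,\nu_1,\nu_2,\nu_3)$ is a third type of Mannheim curve.
   Context: All maps are $C^\infty$. $\Delta=\{(\mathbf{a},\mathbf{b},\mathbf{c})\in S^3\times S^3\times S^3 : \mathbf{a}\cdot\mathbf{b}=\mathbf{a}\cdot\mathbf{c}=\mathbf{b}\cdot\mathbf{c}=0\}$. A smooth map $(\gamma,\nu_1,\nu_2,\nu_3):I\to\mathbb{R}^4\times\Delta$ is a framed curve if $\dot\gamma(t)\cdot\nu_i(t)=0$ for $i=1,2,3$ and all $t\in I$. Definition. Let $(\gamma,\nu_1,\nu_2,\nu_3)$ and $(\overline\gamma,\overline\nu_1,\overline\nu_2,\overline\nu_3):I\to\mathbb{R}^4\times\Delta$ be framed curves with $\gamma\not\equiv\overline\gamma$. They are Bertrand mates (respectively, second type of Mannheim mates; third type of Mannheim mates) if there is a smooth function $\lambda:I\to\mathbb{R}$ such that $\overline\gamma(t)=\gamma(t)+\lambda(t)\nu_1(t)$ and $\nu_1(t)=\overline\nu_1(t)$ (respectively, $\nu_1(t)=\overline\nu_2(t)$; $\nu_1(t)=\overline\nu_3(t)$) for all $t\in I$. A framed curve $(\gamma,\nu_1,\nu_2,\nu_3)$ is a Bertrand curve (respectively,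 second type of Mannheim curve; third type of Mannheim curve) if there exists a framed curve $(\overline\gamma,\overline\nu_1,\overline\nu_2,\overline\nu_3)$ with $\overline\gamma\not\equiv\gamma$ such that the two are Bertrand mates (respectively, second type of Mannheim mates; third type of Mannheim mates). *)

theory Defs
  imports "HOL-Analysis.Analysis"
begin

text \<open>
  Derivatives are taken within the interval, i.e. they are one-sided at those end points that
  belong to it. They are only meaningful (unique) if the interval is nondegenerate.
\<close>

primrec iter_deriv :: "real set \<Rightarrow> nat \<Rightarrow> (real \<Rightarrow> 'a::real_normed_vector) \<Rightarrow> real \<Rightarrow> 'a" where
  "iter_deriv I 0 f = f"
| "iter_deriv I (Suc n) f = (\<lambda>t. vector_derivative (iter_deriv I n f) (at t within I))"

definition smooth_on :: "real set \<Rightarrow> (real \<Rightarrow> 'a::real_normed_vector) \<Rightarrow> bool" where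
  "smooth_on I f \<longleftrightarrow> (\<forall>n. iter_deriv I n f differentiable_on I)"

definition Delta :: "((real^4) \<times> (real^4) \<times> (real^4)) set" where
  "Delta = {(a, b, c). a \<in> sphere 0 1 \<and> b \<in> sphere 0 1 \<and> c \<in> sphere 0 1 \<and>
              a \<bullet> b = 0 \<and> a \<bullet> c = 0 \<and> b \<bullet> c = 0}"

text \<open>
  Curves on \<open>I\<close> are total functions on the reals of which only the values on \<open>I\<close> matter.
  Smoothness of a map into \<open>Delta\<close> is smoothness into the ambient vector space.
\<close>

definition framed_curve ::
  "real set \<Rightarrow> (real \<Rightarrow> real^4) \<Rightarrow> (real \<Rightarrow> real^4) \<Rightarrow> (real \<Rightarrow> real^4) \<Rightarrow> (real \<Rightarrow> real^4) \<Rightarrow> bool" where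
  "framed_curve I \<gamma> \<nu>1 \<nu>2 \<nu>3 \<longleftrightarrow>
     smooth_on I (\<lambda>t. (\<gamma> t, \<nu>1 t, \<nu>2 t, \<nu>3 t)) \<and>
     (\<forall>t\<in>I. (\<nu>1 t, \<nu>2 t, \<nu>3 t) \<in> Delta) \<and>
     (\<forall>t\<in>I. vector_derivative \<gamma> (at t within I) \<bullet> \<nu>1 t = 0 \<and>
             vector_derivative \<gamma> (at t within I) \<bullet> \<nu>2 t = 0 \<and>
             vector_derivative \<gamma> (at t within I) \<bullet> \<nu>3 t = 0)"

definition bertrand_mates where
  "bertrand_mates I \<gamma> \<nu>1 \<nu>2 \<nu>3 \<gamma>' \<nu>1' \<nu>2' \<nu>3' \<longleftrightarrow>
     framed_curve I \<gamma> \<nu>1 \<nu>2 \<nu>3 \<and> framed_curve I \<gamma>' \<nu>1' \<nu>2' \<nu>3' \<and> (\<exists>t\<in>I. \<gamma> t \<noteq> \<gamma>' t) \<and>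
     (\<exists>l::real \<Rightarrow> real. smooth_on I l \<and>
        (\<forall>t\<in>I. \<gamma>' t = \<gamma> t + l t *\<^sub>R \<nu>1 t \<and> \<nu>1 t = \<nu>1' t))"

definition mannheim2_mates where
  "mannheim2_mates I \<gamma> \<nu>1 \<nu>2 \<nu>3 \<gamma>' \<nu>1' \<nu>2' \<nu>3' \<longleftrightarrow>
     framed_curve I \<gamma> \<nu>1 \<nu>2 \<nu>3 \<and> framed_curve I \<gamma>' \<nu>1' \<nu>2' \<nu>3' \<and> (\<exists>t\<in>I. \<gamma> t \<noteq> \<gamma>' t) \<and>
     (\<exists>l::real \<Rightarrow> real. smooth_on I l \<and>
        (\<forall>t\<in>I. \<gamma>' t = \<gamma> t + l t *\<^sub>R \<nu>1 t \<and> \<nu>1 t = \<nu>2' t))"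

definition mannheim3_mates where
  "mannheim3_mates I \<gamma> \<nu>1 \<nu>2 \<nu>3 \<gamma>' \<nu>1' \<nu>2' \<nu>3' \<longleftrightarrow>
     framed_curve I \<gamma> \<nu>1 \<nu>2 \<nu>3 \<and> framed_curve I \<gamma>' \<nu>1' \<nu>2' \<nu>3' \<and> (\<exists>t\<in>I. \<gamma> t \<noteq> \<gamma>' t) \<and>
     (\<exists>l::real \<Rightarrow> real. smooth_on I l \<and>
        (\<forall>t\<in>I. \<gamma>' t = \<gamma> t + l t *\<^sub>R \<nu>1 t \<and> \<nu>1 t = \<nu>3' t))"

definition bertrand_curve where
  "bertrand_curve I \<gamma> \<nu>1 \<nu>2 \<nu>3 \<longleftrightarrow>
     (\<exists>\<gamma>' \<nu>1' \<nu>2' \<nu>3'. bertrand_mates I \<gamma> \<nu>1 \<nu>2 \<nu>3 \<gamma>' \<nu>1' \<nu>2' \<nu>3')"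

definition mannheim2_curve where
  "mannheim2_curve I \<gamma> \<nu>1 \<nu>2 \<nu>3 \<longleftrightarrow>
     (\<exists>\<gamma>' \<nu>1' \<nu>2' \<nu>3'. mannheim2_mates I \<gamma> \<nu>1 \<nu>2 \<nu>3 \<gamma>' \<nu>1' \<nu>2' \<nu>3')"

definition mannheim3_curve where
  "mannheim3_curve I \<gamma> \<nu>1 \<nu>2 \<nu>3 \<longleftrightarrow>
     (\<exists>\<gamma>' \<nu>1' \<nu>2' \<nu>3'. mannheim3_mates I \<gamma> \<nu>1 \<nu>2 \<nu>3 \<gamma>' \<nu>1' \<nu>2' \<nu>3')"

end

theory Submission
  imports Defs
begin

text \<open>
  A framing of a curve consists of three orthonormal fields, all orthogonal to its velocity, and
  nothing in this condition singles out an order or an orientation of the three. Permuting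
  the vectors of a framing therefore gives a framing of the same curve
  (\<open>framed_curve_swap12\<close>, \<open>framed_curve_swap23\<close>). The
  three notions of mate impose the same relation \<open>\<gamma>' = \<gamma> + \<lambda> \<nu>1\<close> between the base
  curves and differ only in which vector of the mate has to coincide with \<open>\<nu>1\<close>. So
  transposing two framing vectors of the mate turns a mate of one type into a mate of another,
  with the same base curve \<open>\<gamma>'\<close> and the same function \<open>\<lambda>\<close>.

  The only analytic content is that a permutation of the framing preserves smoothness. It acts on
  the tuple of the curve and its framing as a linear map, and bounded linear maps commute with all
  iterated derivatives (\<open>smooth_on_bounded_linear\<close>). This is where the interval has to be
  nondegenerate, since otherwise derivatives within it are not unique.
\<close>

lemma nondegenerate_interval_limpt:
  fixes I :: "real set"
  assumes "is_interval I" and "interior I \<noteq> {}" and "t \<in> I"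
  shows "t islimpt I"
proof (rule connected_imp_perfect)
  show "connected I"
    using assms(1) by (rule is_interval_connected)
  show "I \<noteq> {a}" for a
    using assms(2) by auto
  show "t \<in> I"
    by (rule assms(3))
qed

text \<open>
  The hypothesis on limit points makes derivatives within \<open>I\<close> unique, so that the chain rule
  determines the values of \<open>vector_derivative\<close>. The equation is restricted to \<open>I\<close> because
  the values of the iterated derivatives elsewhere are arbitrary.
\<close>

lemma iter_deriv_bounded_linear:
  assumes L: "bounded_linear L" and lim: "\<And>t. t \<in> I \<Longrightarrow> t islimpt I"
    and f: "smooth_on I f" and "t \<in> I"
  shows "iter_deriv I n (\<lambda>s. L (f s)) t = L (iter_deriv I n f t)"
  using \<open>t \<in> I\<close>
proof (induction n arbitrary: t)
  case 0
  then show ?case by simp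
next
  case (Suc n)
  have "iter_deriv I n f differentiable (at t within I)"
    using f Suc.prems by (simp add: smooth_on_def differentiable_on_def)
  then have "(iter_deriv I n f has_vector_derivative iter_deriv I (Suc n) f t) (at t within I)"
    by (simp add: vector_derivative_works)
  then have "((\<lambda>s. L (iter_deriv I n f s)) has_vector_derivative L (iter_deriv I (Suc n) f t))
      (at t within I)"
    by (rule bounded_linear.has_vector_derivative[OF L])
  then have "(iter_deriv I n (\<lambda>s. L (f s)) has_vector_derivative L (iter_deriv I (Suc n) f t))
      (at t within I)"
    by (rule has_vector_derivative_transform[OF Suc.prems, rotated]) (simp add: Suc.IH)
  moreover have "at t within I \<noteq> bot"
    using lim[OF Suc.prems] by (simp add: trivial_limit_within)
  ultimately show ?case
    by (simp add: vector_derivative_within)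
qed

lemma smooth_on_bounded_linear:
  assumes L: "bounded_linear L" and lim: "\<And>t. t \<in> I \<Longrightarrow> t islimpt I" and f: "smooth_on I f"
  shows "smooth_on I (\<lambda>s. L (f s))"
  unfolding smooth_on_def
proof
  fix n
  have "(\<lambda>s. L (iter_deriv I n f s)) differentiable_on I"
    using f bounded_linear_imp_differentiable_on[OF L]
    by (auto simp: smooth_on_def intro: differentiable_on_compose)
  then show "iter_deriv I n (\<lambda>s. L (f s)) differentiable_on I"
    unfolding differentiable_on_def
    by (metis differentiable_transform_within iter_deriv_bounded_linear[OF L lim f] zero_less_one)
qed

lemma framed_curve_swap12:
  assumes lim: "\<And>t. t \<in> I \<Longrightarrow> t islimpt I" and fc: "framed_curve I \<gamma> \<nu>1 \<nu>2 \<nu>3"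
  shows "framed_curve I \<gamma> \<nu>2 \<nu>1 \<nu>3"
proof -
  let ?L = "\<lambda>p :: (real^4) \<times> (real^4) \<times> (real^4) \<times> (real^4).
    (fst p, fst (snd (snd p)), fst (snd p), snd (snd (snd p)))"
  have "bounded_linear ?L"
    by (intro bounded_linear_intros)
  then have "smooth_on I (\<lambda>t. ?L (\<gamma> t, \<nu>1 t, \<nu>2 t, \<nu>3 t))"
    by (rule smooth_on_bounded_linear) (use lim fc in \<open>auto simp: framed_curve_def\<close>)
  then show ?thesis
    using fc by (auto simp: framed_curve_def Delta_def inner_commute)
qed

lemma framed_curve_swap23:
  assumes lim: "\<And>t. t \<in> I \<Longrightarrow> t islimpt I" and fc: "framed_curve I \<gamma> \<nu>1 \<nu>2 \<nu>3"
  shows "framed_curve I \<gamma> \<nu>1 \<nu>3 \<nu>2"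
proof -
  let ?L = "\<lambda>p :: (real^4) \<times> (real^4) \<times> (real^4) \<times> (real^4).
    (fst p, fst (snd p), snd (snd (snd p)), fst (snd (snd p)))"
  have "bounded_linear ?L"
    by (intro bounded_linear_intros)
  then have "smooth_on I (\<lambda>t. ?L (\<gamma> t, \<nu>1 t, \<nu>2 t, \<nu>3 t))"
    by (rule smooth_on_bounded_linear) (use lim fc in \<open>auto simp: framed_curve_def\<close>)
  then show ?thesis
    using fc by (auto simp: framed_curve_def Delta_def inner_commute)
qed

theorem theorem4p3:
  fixes I :: "real set"
    and \<gamma> \<nu>1 \<nu>2 \<nu>3 :: "real \<Rightarrow> real^4"
  assumes "is_interval I" and "interior I \<noteq> {}"
    and "framed_curve I \<gamma> \<nu>1 \<nu>2 \<nu>3"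
  shows "(bertrand_curve I \<gamma> \<nu>1 \<nu>2 \<nu>3 \<longleftrightarrow> mannheim2_curve I \<gamma> \<nu>1 \<nu>2 \<nu>3) \<and>
         (mannheim2_curve I \<gamma> \<nu>1 \<nu>2 \<nu>3 \<longleftrightarrow> mannheim3_curve I \<gamma> \<nu>1 \<nu>2 \<nu>3)"
proof -
  have lim: "t islimpt I" if "t \<in> I" for t
    using nondegenerate_interval_limpt assms(1,2) that .
  have swap12: "framed_curve I c a b d \<longleftrightarrow> framed_curve I c b a d" for c a b d
    using framed_curve_swap12 lim by blast
  have swap23: "framed_curve I c a b d \<longleftrightarrow> framed_curve I c a d b" for c a b d
    using framed_curve_swap23 lim by blast
  have "bertrand_mates I \<gamma> \<nu>1 \<nu>2 \<nu>3 c a b d \<longleftrightarrow> mannheim2_mates I \<gamma> \<nu>1 \<nu>2 \<nu>3 c b a d" for c a b d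
    unfolding bertrand_mates_def mannheim2_mates_def using swap12[of c a b d] by simp
  moreover have "mannheim2_mates I \<gamma> \<nu>1 \<nu>2 \<nu>3 c a b d \<longleftrightarrow> mannheim3_mates I \<gamma> \<nu>1 \<nu>2 \<nu>3 c a d b"
    for c a b d
    unfolding mannheim2_mates_def mannheim3_mates_def using swap23[of c a b d] by simp
  ultimately show ?thesis
    unfolding bertrand_curve_def mannheim2_curve_def mannheim3_curve_def by blast
qed

end
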